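(* Let $\Delta_3^rW=\Delta_3^r x_{i_1}^{s_1}x_{i_2}^{s_2}\cdots x_{i_h}^{s_h}$ be a summit word, written in syllable form. Then it is the smallest summit word in its summit set if and only if one of the following holds: (0) $\Delta_3^rW$ is $\Delta_3^{r}$ with $r$ odd, or $\Delta_3^{r}x_1^{s_1}$ with $r$ even and $s_1\ge 0$; or $\Delta_3^rW$ satisfies all of the following conditions: (a) $x_{i_1}=x_1$, and (b) $h\equiv r\pmod 2$, and (c) $(s_1,\dots,s_h)$ satisfies the max-min condition.
   Context: $\mathcal{B}_3=\langle x_1,x_2 : x_2x_1x_2=x_1x_2x_1\rangle$ is the 3-braid group. $\mathcal{MB}_3\subset\mathcal{B}_3$ is the monoid of positive elements (products of $x_1,x_2$). $\Delta_3=x_1x_2x_1$, and $\mathcal{MB}_3^+=\mathcal{MB}_3\setminus\Delta_3\mathcal{MB}_3$. Every element of $\mathcal{B}_3$ is uniquely $\Delta_3^rW$ with $r\in\mathbb{Z}$, $W\in\mathcal{MB}_3^+$ (Garside normal form). Each element of $\mathcal{MB}_3^+$ is represented by exactly one positive word in $x_1,x_2$. Syllable form of $W$: $W=x_{i_1}^{s_1}\cdots x_{i_h}^{s_h}$ with $h\ge0$, $i_j\in\{1,2\}$, $i_j\ne i_{j+1}$, $s_j\ge1$ ($h=0$ means $W=1$; condition (a) requires $h\ge 1$). For a conjugacy class $C$ of $\mathcal{B}_3$, $\exp(C)$ is the maximum (which exists, by Garside) of the integers $r$ such that $\Delta_3^rW\in C$ for some $W\in\mathcal{MB}_3^+$.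 The summit set is $SS(C)=\{\Delta_3^rW\in C : W\in\mathcal{MB}_3^+,\ r=\exp(C)\}$ and the base-summit set of $C$ is the set of $W\in\mathcal{MB}_3^+$ with $\Delta_3^{\exp(C)}W\in SS(C)$. An expression $\Delta_3^rW$ in normal form is a summit word if it belongs to the summit set of its conjugacy class. A summit word $\Delta_3^rW$ is the smallest summit word if $W$ is the smallest element of its base-summit set for the length-lexicographic order on positive words with $x_2>x_1$. Max-min condition: a finite sequence $(s_1,\dots,s_h)$ satisfies it if it is selected among its cyclic shifts by successively taking the first entry maximal, then the second entry minimal, then the third entry maximal, and so on alternately. That is, for every cyclic shift $(t_1,\dots,t_h)=(s_k,\dots,s_h,s_1,\dots,s_{k-1})$ different from $(s_1,\dots,s_h)$, if $j$ is the first index with $s_j\ne t_j$, then $s_j>t_j$ when $j$ is odd and $s_j<t_j$ when $j$ is even. *)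

theory Defs
  imports "HOL-Number_Theory.Cong"
begin

datatype gen = X1 | X2

(* The letter (i, True) is the generator i, the letter (i, False) its formal inverse. *)
type_synonym letter = "gen \<times> bool"

inductive braid_eq :: "letter list \<Rightarrow> letter list \<Rightarrow> bool" where
  refl: "braid_eq u u"
| sym: "braid_eq u v \<Longrightarrow> braid_eq v u"
| trans: "braid_eq u v \<Longrightarrow> braid_eq v w \<Longrightarrow> braid_eq u w"
| append: "braid_eq u u' \<Longrightarrow> braid_eq v v' \<Longrightarrow> braid_eq (u @ v) (u' @ v')"
| cancel: "braid_eq [(i, b), (i, \<not> b)] []"
| relator: "braid_eq [(X2, True), (X1, True), (X2, True)] [(X1, True), (X2, True), (X1, True)]"

definition word_inv :: "letter list \<Rightarrow> letter list" where
  "word_inv w = rev (map (\<lambda>(i, b). (i, \<not> b)) w)"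

lemma word_inv_cancel_left: "braid_eq (word_inv w @ w) []"
proof (induction w)
  case Nil
  show ?case by (simp add: word_inv_def braid_eq.refl)
next
  case (Cons a w)
  obtain i b where a: "a = (i, b)" by (cases a)
  have "braid_eq [(i, \<not> b), (i, b)] []"
    using braid_eq.cancel[of i "\<not> b"] by simp
  from braid_eq.append[OF braid_eq.refl[of "word_inv w"] braid_eq.append[OF this braid_eq.refl[of w]]]
  have "braid_eq (word_inv (a # w) @ (a # w)) (word_inv w @ w)"
    by (simp add: word_inv_def a)
  then show ?case using Cons.IH by (rule braid_eq.trans)
qed

lemma word_inv_word_inv: "word_inv (word_inv w) = w"
  by (induction w) (auto simp: word_inv_def)

lemma word_inv_cancel_right: "braid_eq (w @ word_inv w) []"
  using word_inv_cancel_left[of "word_inv w"] by (simp add: word_inv_word_inv)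

lemma word_inv_cong:
  assumes "braid_eq u v"
  shows "braid_eq (word_inv u) (word_inv v)"
proof -
  have 1: "braid_eq (word_inv u) (word_inv u @ v @ word_inv v)"
    using braid_eq.append[OF braid_eq.refl[of "word_inv u"]
        braid_eq.sym[OF word_inv_cancel_right[of v]]] by simp
  have 2: "braid_eq (word_inv u @ v @ word_inv v) (word_inv u @ u @ word_inv v)"
    by (rule braid_eq.append[OF braid_eq.refl
          braid_eq.append[OF braid_eq.sym[OF assms] braid_eq.refl]])
  have 3: "braid_eq (word_inv u @ u @ word_inv v) (word_inv v)"
    using braid_eq.append[OF word_inv_cancel_left[of u] braid_eq.refl[of "word_inv v"]] by simp
  show ?thesis
    by (rule braid_eq.trans[OF 1 braid_eq.trans[OF 2 3]])
qed

quotient_type braid3 = "letter list" / braid_eq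
proof (rule equivpI)
  show "reflp braid_eq" by (rule reflpI) (rule braid_eq.refl)
  show "symp braid_eq" by (rule sympI) (rule braid_eq.sym)
  show "transp braid_eq" by (rule transpI) (rule braid_eq.trans)
qed

instantiation braid3 :: "{monoid_mult, inverse}"
begin

lift_definition one_braid3 :: braid3 is "[]" .

lift_definition times_braid3 :: "braid3 \<Rightarrow> braid3 \<Rightarrow> braid3" is append
  by (rule braid_eq.append)

lift_definition inverse_braid3 :: "braid3 \<Rightarrow> braid3" is word_inv
  by (rule word_inv_cong)

definition divide_braid3 :: "braid3 \<Rightarrow> braid3 \<Rightarrow> braid3" where
  "divide_braid3 g h = g * inverse h"

instance
  by standard (transfer; simp add: braid_eq.refl)+

end

lift_definition braid_gen :: "gen \<Rightarrow> braid3" is "\<lambda>i. [(i, True)]" .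

lemma braid3_left_inverse: "inverse g * g = 1" for g :: braid3
  by transfer (rule word_inv_cancel_left)

lemma braid3_right_inverse: "g * inverse g = 1" for g :: braid3
  by transfer (rule word_inv_cancel_right)

lemma braid3_relation: "braid_gen X2 * braid_gen X1 * braid_gen X2 = braid_gen X1 * braid_gen X2 * braid_gen X1"
  by transfer (simp add: braid_eq.relator)

definition conj_class :: "braid3 \<Rightarrow> braid3 set" where
  "conj_class g = range (\<lambda>h. h * g * inverse h)"

definition Delta :: braid3 where
  "Delta = braid_gen X1 * braid_gen X2 * braid_gen X1"

definition pos_braid :: "gen list \<Rightarrow> braid3" where
  "pos_braid w = prod_list (map braid_gen w)"

definition MB :: "braid3 set" where
  "MB = range pos_braid"

definition MB_plus :: "braid3 set" where
  "MB_plus = MB - (\<lambda>V. Delta * V) ` MB"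

definition exp_class :: "braid3 set \<Rightarrow> int" where
  "exp_class C = (GREATEST r. \<exists>W \<in> MB_plus. Delta powi r * W \<in> C)"

definition summit_set :: "braid3 set \<Rightarrow> braid3 set" where
  "summit_set C = {Delta powi r * W | r W. W \<in> MB_plus \<and> Delta powi r * W \<in> C \<and> r = exp_class C}"

definition base_summit_set :: "braid3 set \<Rightarrow> braid3 set" where
  "base_summit_set C = {W \<in> MB_plus. Delta powi exp_class C * W \<in> summit_set C}"

(* The expression Delta^r W is represented by the pair of r and W. *)
definition summit_word :: "int \<Rightarrow> braid3 \<Rightarrow> bool" where
  "summit_word r W \<longleftrightarrow>
     W \<in> MB_plus \<and> Delta powi r * W \<in> summit_set (conj_class (Delta powi r * W))"

(* Meaningful on MB_plus, whose elements are represented by exactly one positive word. *)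
definition word_of :: "braid3 \<Rightarrow> gen list" where
  "word_of W = (THE w. pos_braid w = W)"

definition less_pos :: "braid3 \<Rightarrow> braid3 \<Rightarrow> bool" where
  "less_pos V W \<longleftrightarrow> (word_of V, word_of W) \<in> lenlex {(X1, X2)}"

definition smallest_summit_word :: "int \<Rightarrow> braid3 \<Rightarrow> bool" where
  "smallest_summit_word r W \<longleftrightarrow> summit_word r W \<and>
     (\<forall>V \<in> base_summit_set (conj_class (Delta powi r * W)). V \<noteq> W \<longrightarrow> less_pos W V)"

(* The pair (i, s) is the syllable x_i^s. *)
definition syllable_list :: "(gen \<times> nat) list \<Rightarrow> bool" where
  "syllable_list ys \<longleftrightarrow>
     (\<forall>(i, s) \<in> set ys. s \<ge> 1) \<and>
     (\<forall>j. Suc j < length ys \<longrightarrow> fst (ys ! j) \<noteq> fst (ys ! Suc j))"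

definition syllable_prod :: "(gen \<times> nat) list \<Rightarrow> braid3" where
  "syllable_prod ys = prod_list (map (\<lambda>(i, s). braid_gen i ^ s) ys)"

(* Lists are indexed from 0, so the odd positions of s_1, ..., s_h are the even indices. *)
definition max_min :: "nat list \<Rightarrow> bool" where
  "max_min s \<longleftrightarrow>
     (\<forall>k < length s. let t = rotate k s in
        \<forall>j < length s. s ! j \<noteq> t ! j \<and> (\<forall>l < j. s ! l = t ! l) \<longrightarrow>
          (if even j then s ! j > t ! j else s ! j < t ! j))"

end

theory Submission
  imports Defs
begin

text \<open>
  Letting the generators act on pairs of a \<open>\<Delta>\<close>-free positive word and an exponent of \<open>\<Delta>\<close> shows
  that \<open>\<Delta>\<close>-free words are determined by the braids that they represent. Since \<open>\<Delta>\<close> interchanges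
  the generators, conjugating \<open>\<Delta>\<^sup>r x U\<close> by \<open>x\<close> moves the first letter to the end, with the generators
  interchanged if \<open>r\<close> is odd, and conjugating by \<open>\<Delta>\<close> interchanges them everywhere. Together with
  Garside's stepwise conjugation by simple elements, this makes the base-summit set of a summit word
  its orbit under twisted rotation and \<open>flip\<close>. If the syllables at the two ends of a nonconstant word
  merge under twisted rotation, then some rotation starts with a longer power of \<open>x\<^sub>1\<close> and is smaller.
  Otherwise the rotations permute the syllables cyclically, and two words that alternate
  from \<open>x\<^sub>1\<close> compare at the first differing exponent: the smaller one has the larger exponent of
  \<open>x\<^sub>1\<close> or the smaller exponent of \<open>x\<^sub>2\<close> there, which is the max-min condition.
\<close>

section \<open>The Garside normal form\<close>

fun flip :: "gen \<Rightarrow> gen" where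
  "flip X1 = X2"
| "flip X2 = X1"

lemma flip_flip [simp]: "flip (flip x) = x"
  by (cases x) auto

lemma flip_neq [simp]: "flip x \<noteq> x" "x \<noteq> flip x"
  by (cases x; simp)+

lemma flip_eq_iff [simp]: "flip x = flip y \<longleftrightarrow> x = y"
  by (metis flip_flip)

lemma neq_iff_flip: "x \<noteq> y \<longleftrightarrow> y = flip x"
  by (cases x; cases y; simp)

lemma flip_comp_flip [simp]: "flip \<circ> flip = id"
  by (simp add: fun_eq_iff)

lemma map_flip_flip [simp]: "map flip (map flip w) = w"
  by simp

text \<open>The forbidden factors are exactly the two positive words for \<open>Delta\<close>, so
  this is \<open>MB_plus\<close> on the level of words.\<close>

fun Delta_free :: "gen list \<Rightarrow> bool" where
  "Delta_free (a # b # c # w) \<longleftrightarrow> \<not> (b = flip a \<and> c = a) \<and> Delta_free (b # c # w)"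
| "Delta_free _ \<longleftrightarrow> True"

lemma Delta_free_map_flip [simp]: "Delta_free (map flip w) \<longleftrightarrow> Delta_free w"
  by (induction w rule: Delta_free.induct) auto

lemma Delta_free_Cons_flip [simp]:
  "Delta_free (flip x # map flip w) \<longleftrightarrow> Delta_free (x # w)"
  using Delta_free_map_flip[of "x # w"] by simp

lemma Delta_free_Cons_Cons_flip [simp]:
  "Delta_free (flip x # flip y # map flip w) \<longleftrightarrow> Delta_free (x # y # w)"
  using Delta_free_map_flip[of "x # y # w"] by simp

lemma Delta_free_ConsD: "Delta_free (a # w) \<Longrightarrow> Delta_free w"
  by (cases w rule: Delta_free.cases) auto

lemma Delta_free_appendD:
  "Delta_free (u @ v) \<Longrightarrow> Delta_free v"
  by (induction u) (auto dest: Delta_free_ConsD)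

lemma not_Delta_freeE:
  assumes "\<not> Delta_free w"
  obtains u x v where "w = u @ [x, flip x, x] @ v"
proof -
  have "\<exists>u x v. w = u @ [x, flip x, x] @ v"
    using assms
  proof (induction w rule: Delta_free.induct)
    case (1 a b c w)
    show ?case
    proof (cases "b = flip a \<and> c = a")
      case True
      then have "a # b # c # w = [] @ [a, flip a, a] @ w" by simp
      then show ?thesis by blast
    next
      case False
      with 1 obtain u x v where "b # c # w = u @ [x, flip x, x] @ v" by auto
      then have "a # b # c # w = (a # u) @ [x, flip x, x] @ v" by simp
      then show ?thesis by blast
    qed
  qed auto
  then show thesis using that by blast
qed

text \<open>A factor \<open>[x, flip x, x]\<close> must straddle the boundary, with two letters on
  one side and one on the other. In both cases \<open>x\<close> is the first letter of
  \<open>g\<close>.\<close>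

lemma Delta_free_junction:
  assumes "Delta_free w" "Delta_free g" "\<not> Delta_free (w @ g)"
  obtains u x g' where "w = u @ [x, flip x]" "g = x # g'"
  | u x g' where "w = u @ [flip x]" "g = x # flip x # g'"
proof -
  have "(\<exists>u x g'. w = u @ [x, flip x] \<and> g = x # g') \<or>
        (\<exists>u x g'. w = u @ [flip x] \<and> g = x # flip x # g')"
    using assms
  proof (induction w rule: Delta_free.induct)
    case (1 a b c w)
    then have "(\<exists>u x g'. b # c # w = u @ [x, flip x] \<and> g = x # g') \<or>
        (\<exists>u x g'. b # c # w = u @ [flip x] \<and> g = x # flip x # g')" by auto
    then show ?case by (metis append_Cons)
  next
    case ("2_3" a b)
    then obtain c g' where g: "g = c # g'" by (cases g) auto
    show ?case
    proof (cases "b = flip a \<and> c = a")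
      case True
      then show ?thesis using g by (metis append_Nil)
    next
      case False
      with "2_3" g have "\<not> Delta_free (b # c # g')" by simp
      then obtain d g'' where "g' = d # g''" "c = flip b" "d = b"
        using "2_3" g by (cases g') (auto split: if_splits)
      then have "[a, b] = [a] @ [flip c] \<and> g = c # flip c # g''" using g by simp
      then show ?thesis by blast
    qed
  next
    case ("2_2" b)
    then obtain c d g'' where "g = c # d # g''" "c = flip b" "d = b"
      by (cases g rule: Delta_free.cases) (auto split: if_splits)
    then have "[b] = [] @ [flip c] \<and> g = c # flip c # g''" by simp
    then show ?case by blast
  qed auto
  then show thesis using that by blast
qed

text \<open>The pair \<open>(w, r)\<close> stands for the braid \<open>w \<Delta>\<^sup>r\<close>, on which letters act by left multiplication.\<close>
fun act :: "letter \<Rightarrow> gen list \<times> int \<Rightarrow> gen list \<times> int" where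
  "act (x, True) (w, r) =
     (if take 2 w = [flip x, x] then (map flip (drop 2 w), r + 1) else (x # w, r))"
| "act (x, False) (w, r) =
     (if take 1 w = [x] then (tl w, r) else (flip x # x # map flip w, r - 1))"

text \<open>An inverse letter that does not cancel is rewritten by
  \<open>x\<^sup>-\<^sup>1 = (flip x) x \<Delta>\<^sup>-\<^sup>1\<close>. No \<open>\<Delta>\<close>
  arises then: as \<open>w\<close> does not start with \<open>x\<close>, \<open>map flip w\<close>
  does not start with \<open>flip x\<close>.\<close>

lemma Delta_free_act: "Delta_free (fst p) \<Longrightarrow> Delta_free (fst (act l p))"
proof (induction l p rule: act.induct)
  case (1 x w r)
  then show ?case
    by (cases w rule: Delta_free.cases)
      (auto dest: Delta_free_ConsD simp: neq_iff_flip)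
next
  case (2 x w r)
  then show ?case
    by (cases w rule: Delta_free.cases)
      (auto dest: Delta_free_ConsD simp: neq_iff_flip)
qed

lemma Delta_free_foldr_act: "Delta_free (fst p) \<Longrightarrow> Delta_free (fst (foldr act u p))"
  by (induction u) (auto intro: Delta_free_act)

lemma act_act_inverse:
  assumes "Delta_free (fst p)"
  shows "act (x, b) (act (x, \<not> b) p) = p"
proof (cases p)
  case (Pair w r)
  then show ?thesis using assms
    by (cases b; cases w rule: Delta_free.cases) (auto simp: neq_iff_flip)
qed

text \<open>The result does not depend on \<open>x\<close>, so both sides of the braid relation act
  alike.\<close>

lemma act_Delta:
  assumes "Delta_free w"
  shows "act (x, True) (act (flip x, True) (act (x, True) (w, r))) = (map flip w, r + 1)"
proof -
  consider "w = []" | v where "w = x # v" | v where "w = flip x # x # v"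
    | v where "w = flip x # v" "take 1 v \<noteq> [x]"
  proof (cases w)
    case (Cons a v)
    then have "w = x # v \<or> (\<exists>v'. w = flip x # x # v') \<or> w = flip x # v \<and> take 1 v \<noteq> [x]"
      by (cases v; cases x; cases a; cases "hd v") auto
    then show thesis using that by blast
  qed (use that in simp)
  then show ?thesis
  proof cases
    case (3 v)
    then show ?thesis using assms by (cases v rule: Delta_free.cases) auto
  next
    case (4 v)
    then show ?thesis using assms by (cases v rule: Delta_free.cases) (auto simp: neq_iff_flip)
  qed auto
qed

lemma foldr_act_braid_eq:
  "braid_eq u v \<Longrightarrow> Delta_free (fst p) \<Longrightarrow> foldr act u p = foldr act v p"
proof (induction arbitrary: p rule: braid_eq.induct)
  case (append u u' v v')
  then show ?case by (simp add: Delta_free_foldr_act)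
next
  case relator
  then show ?case
    using act_Delta[of "fst p" X1 "snd p"] act_Delta[of "fst p" X2 "snd p"] by simp
qed (simp_all add: act_act_inverse)

lift_definition normal_form :: "braid3 \<Rightarrow> gen list \<times> int" is "\<lambda>u. foldr act u ([], 0)"
  by (simp add: foldr_act_braid_eq)

lemma pos_braid_Nil [simp]: "pos_braid [] = 1"
  by (simp add: pos_braid_def)

lemma pos_braid_Cons: "pos_braid (x # w) = braid_gen x * pos_braid w"
  by (simp add: pos_braid_def)

lemma pos_braid_append: "pos_braid (u @ v) = pos_braid u * pos_braid v"
  by (simp add: pos_braid_def)

lemma normal_form_one: "normal_form 1 = ([], 0)"
  by transfer simp

lemma normal_form_gen_times: "normal_form (braid_gen x * g) = act (x, True) (normal_form g)"
  by transfer simp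

text \<open>A positive letter never lowers the exponent. If it is still 0 at the end, no
  \<open>\<Delta>\<close> was ever absorbed and the word has only been copied.\<close>

lemma normal_form_pos_braid:
  "snd (normal_form (pos_braid w)) \<ge> 0 \<and>
   (snd (normal_form (pos_braid w)) = 0 \<longrightarrow> fst (normal_form (pos_braid w)) = w)"
proof (induction w)
  case (Cons x w)
  then show ?case
    by (cases "normal_form (pos_braid w)")
      (auto simp: pos_braid_Cons normal_form_gen_times)
qed (simp add: normal_form_one)

lemma normal_form_Delta_free:
  "Delta_free w \<Longrightarrow> normal_form (pos_braid w) = (w, 0)"
proof (induction w)
  case (Cons x w)
  then have "normal_form (pos_braid w) = (w, 0)" using Delta_free_ConsD by blast
  then have "normal_form (pos_braid (x # w)) = act (x, True) (w, 0)"
    by (simp only: pos_braid_Cons normal_form_gen_times)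
  with Cons.prems show ?case
    by (cases w rule: Delta_free.cases) (auto simp del: pos_braid_Cons)
qed (simp add: normal_form_one)

text \<open>The common normal form has exponent 0, which already forces \<open>v\<close> to be its
  own normal form. Hence only one of the two words has to be free of
  \<open>\<Delta>\<close>.\<close>

lemma pos_braid_eq_Delta_free:
  assumes "pos_braid v = pos_braid w" "Delta_free w"
  shows "v = w"
  using normal_form_pos_braid[of v] normal_form_Delta_free[OF assms(2)] assms(1)
  by (metis fst_conv snd_conv)

section \<open>Powers of \<open>\<Delta>\<close>, conjugacy and exponents\<close>

lemma braid3_left_cancel: "g * h = g * k \<Longrightarrow> h = k" for g h k :: braid3
  by (metis braid3_left_inverse mult.assoc mult_1_left)

lemma braid3_inverse_left [simp]: "inverse g * (g * h) = h" for g h :: braid3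
  by (metis braid3_left_inverse mult.assoc mult_1_left)

lemma braid3_inverse_right [simp]: "g * (inverse g * h) = h" for g h :: braid3
  by (metis braid3_right_inverse mult.assoc mult_1_left)

lemma braid3_powi_add_one: "g powi (r + 1) = g powi r * g" for g :: braid3
proof (cases "r \<ge> 0")
  case True
  then show ?thesis by (simp add: power_int_def nat_add_distrib power_commutes)
next
  case False
  then obtain n where n: "r = - int (Suc n)"
    by (metis not_le zero_less_imp_eq_int minus_equation_iff neg_less_0_iff_less gr0_implies_Suc)
  have "inverse g ^ Suc n * g = inverse g ^ n"
    by (simp add: power_commutes[symmetric] mult.assoc braid3_left_inverse del: power_Suc add: power_Suc2)
  with n show ?thesis
    by (simp add: power_int_def nat_add_distrib)
qed

lemma braid3_powi_diff_one: "g powi (r - 1) = g powi r * inverse g" for g :: braid3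
  using braid3_powi_add_one[of g "r - 1"] by (simp add: mult.assoc braid3_right_inverse)

lemma braid3_powi_add: "g powi (r + s) = g powi r * g powi s" for g :: braid3
proof (induction s rule: int_induct[of _ 0])
  case (step1 i)
  then show ?case
    using braid3_powi_add_one[of g "r + i"] by (simp add: braid3_powi_add_one mult.assoc add.assoc)
next
  case (step2 i)
  then show ?case
    using braid3_powi_diff_one[of g "r + i"] by (simp add: braid3_powi_diff_one mult.assoc algebra_simps)
qed simp

lemma braid_gen_triple:
  "braid_gen x * (braid_gen (flip x) * braid_gen x) = Delta"
  using braid3_relation by (cases x) (simp_all add: Delta_def mult.assoc)

lemma pos_braid_triple: "pos_braid [x, flip x, x] = Delta"
  by (simp add: pos_braid_Cons braid_gen_triple)

lemma Delta_gen: "Delta * braid_gen x = braid_gen (flip x) * Delta"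
  using braid_gen_triple[of x] braid_gen_triple[of "flip x"]
  by (metis flip_flip mult.assoc)

lemma Delta_pos_braid: "Delta * pos_braid w = pos_braid (map flip w) * Delta"
proof (induction w)
  case (Cons x w)
  then show ?case by (metis Delta_gen list.simps(9) mult.assoc pos_braid_Cons)
qed simp

text \<open>On its way to the front, \<open>\<Delta>\<close> interchanges the generators in every
  letter that it passes.\<close>

lemma pos_braid_triple_middle:
  "pos_braid (u @ [x, flip x, x] @ v) = Delta * pos_braid (map flip u @ v)"
  using Delta_pos_braid[of "map flip u"] pos_braid_triple[of x]
  by (simp add: pos_braid_append mult.assoc del: append.simps map_map)
     (metis mult.assoc map_flip_flip)

text \<open>The effect on letters of conjugation by \<open>\<Delta>\<^sup>r\<close>; only the parity
  matters because \<open>\<Delta>\<^sup>2\<close> is central.\<close>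

definition twist :: "int \<Rightarrow> gen \<Rightarrow> gen" where
  "twist r x = (if even r then x else flip x)"

lemma twist_twist [simp]: "twist r (twist r x) = x"
  by (simp add: twist_def)

lemma twist_flip [simp]: "twist r (flip x) = flip (twist r x)"
  by (simp add: twist_def)

lemma twist_comp_twist [simp]: "twist r \<circ> twist r = id"
  by (simp add: fun_eq_iff)

lemma map_twist: "map (twist r) w = (if even r then w else map flip w)"
  by (auto simp: twist_def intro: map_idI)

lemma map_twist_twist [simp]: "map (twist r) (map (twist r) w) = w"
  by (simp add: comp_def)

lemma Delta_powi_pos_braid:
  "Delta powi r * pos_braid w = pos_braid (map (twist r) w) * Delta powi r"
proof (induction r arbitrary: w rule: int_induct[of _ 0])
  case base
  show ?case by (simp add: map_twist)
next
  case (step1 i)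
  have "Delta powi (i + 1) * pos_braid w = Delta powi i * pos_braid (map flip w) * Delta"
    by (simp add: braid3_powi_add_one mult.assoc Delta_pos_braid)
  also have "\<dots> = pos_braid (map (twist i) (map flip w)) * Delta powi (i + 1)"
    by (simp only: step1.IH braid3_powi_add_one mult.assoc)
  also have "map (twist i) (map flip w) = map (twist (i + 1)) w"
    by (simp add: map_twist del: map_map)
  finally show ?case .
next
  case (step2 i)
  have "inverse Delta * pos_braid w = inverse Delta * (Delta * pos_braid (map flip w)) * inverse Delta"
    using Delta_pos_braid[of "map flip w"]
    by (simp only: map_flip_flip mult.assoc) (simp add: braid3_right_inverse)
  then have "inverse Delta * pos_braid w = pos_braid (map flip w) * inverse Delta" by simp
  then have "Delta powi (i - 1) * pos_braid w = Delta powi i * pos_braid (map flip w) * inverse Delta"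
    by (simp add: braid3_powi_diff_one mult.assoc)
  also have "\<dots> = pos_braid (map (twist i) (map flip w)) * Delta powi (i - 1)"
    by (simp only: step2.IH braid3_powi_diff_one mult.assoc)
  also have "map (twist i) (map flip w) = map (twist (i - 1)) w"
    by (simp add: map_twist del: map_map)
  finally show ?case .
qed

text \<open>The homomorphism to the integers that sends both generators to 1. It is constant on
  conjugacy classes and will bound the exponents of \<open>\<Delta>\<close> there.\<close>

lift_definition expo :: "braid3 \<Rightarrow> int" is "\<lambda>u. \<Sum>(i, b)\<leftarrow>u. if b then 1 else - 1"
proof -
  fix u v
  assume "braid_eq u v"
  then show "(\<Sum>(i, b)\<leftarrow>u. if b then 1 else - 1) = (\<Sum>(i, b)\<leftarrow>v. if b then 1 else - 1 :: int)"
    by induction auto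
qed

lemma expo_one [simp]: "expo 1 = 0"
  by transfer simp

lemma expo_times [simp]: "expo (g * h) = expo g + expo h"
  by transfer simp

lemma expo_inverse [simp]: "expo (inverse g) = - expo g"
  using expo_times[of "inverse g" g] by (simp add: braid3_left_inverse)

lemma expo_pos_braid [simp]: "expo (pos_braid w) = int (length w)"
proof (induction w)
  case (Cons x w)
  have "expo (braid_gen x) = 1" by transfer simp
  with Cons show ?case by (simp add: pos_braid_Cons)
qed simp

lemma expo_Delta [simp]: "expo Delta = 3"
  using expo_pos_braid[of "[X1, flip X1, X1]"] by (simp only: pos_braid_triple) simp

lemma expo_Delta_powi [simp]: "expo (Delta powi r) = 3 * r"
  by (induction r rule: int_induct[of _ 0])
    (simp_all add: braid3_powi_add_one braid3_powi_diff_one)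

section \<open>Conjugacy classes\<close>

lemma mem_conj_class_iff: "b \<in> conj_class a \<longleftrightarrow> (\<exists>h. b * h = h * a)"
  unfolding conj_class_def image_iff
  by (metis UNIV_I braid3_left_inverse braid3_right_inverse mult.assoc mult_1_right)

lemma mem_conj_class_iff': "b \<in> conj_class a \<longleftrightarrow> (\<exists>h. a * h = h * b)"
proof
  assume "b \<in> conj_class a"
  then obtain h where "b * h = h * a" by (auto simp: mem_conj_class_iff)
  then have "a * inverse h = inverse h * b"
    by (metis braid3_inverse_left braid3_right_inverse mult.assoc mult_1_right)
  then show "\<exists>h. a * h = h * b" by blast
next
  assume "\<exists>h. a * h = h * b"
  then obtain h where "a * h = h * b" by blast
  then have "b * inverse h = inverse h * a"
    by (metis braid3_inverse_left braid3_right_inverse mult.assoc mult_1_right)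
  then show "b \<in> conj_class a" by (auto simp: mem_conj_class_iff)
qed

lemma conj_class_refl: "a \<in> conj_class a"
  using mem_conj_class_iff[of a a] by (metis mult_1_left mult_1_right)

lemma conj_class_trans: "b \<in> conj_class a \<Longrightarrow> c \<in> conj_class b \<Longrightarrow> c \<in> conj_class a"
  unfolding mem_conj_class_iff by (metis mult.assoc)

lemma expo_conj_class: "b \<in> conj_class a \<Longrightarrow> expo b = expo a"
  unfolding conj_class_def by auto

section \<open>Existence of the normal form\<close>

lemma pos_braid_decomp:
  "\<exists>k w. k \<ge> 0 \<and> (\<not> Delta_free v \<longrightarrow> k > 0) \<and> Delta_free w \<and>
     pos_braid v = Delta powi k * pos_braid w"
proof (induction "length v" arbitrary: v rule: less_induct)
  case less
  show ?case
  proof (cases "Delta_free v")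
    case True
    then show ?thesis by (intro exI[of _ 0] exI[of _ v]) simp
  next
    case False
    then obtain u x u' where v: "v = u @ [x, flip x, x] @ u'" by (rule not_Delta_freeE)
    \<comment> \<open>Pulling \<open>\<Delta>\<close> to the front leaves a word that is shorter by
      three letters.\<close>
    then obtain k w where kw: "k \<ge> 0" "Delta_free w"
        "pos_braid (map flip u @ u') = Delta powi k * pos_braid w"
      using less[of "map flip u @ u'"] by auto
    have "pos_braid v = Delta * (Delta powi k * pos_braid w)"
      unfolding v pos_braid_triple_middle kw(3) ..
    also have "\<dots> = Delta powi (k + 1) * pos_braid w"
      using braid3_powi_add[of Delta 1 k] by (simp add: mult.assoc add.commute)
    finally show ?thesis using kw by (intro exI[of _ "k + 1"] exI[of _ w]) simp
  qed
qed

lemma letter_Delta: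
  "\<exists>k v. abs_braid3 [l] = Delta powi k * pos_braid v"
proof (cases l)
  case (Pair x b)
  have gen: "abs_braid3 [(x, True)] = pos_braid [x]" for x
    by (simp add: pos_braid_Cons braid_gen.abs_eq)
  show ?thesis
  proof (cases b)
    case True
    then show ?thesis using Pair gen by (intro exI[of _ 0]) auto
  next
    case False
    have "abs_braid3 [(x, False)] = inverse (braid_gen x)"
      by (simp add: braid_gen.abs_eq inverse_braid3.abs_eq word_inv_def)
    \<comment> \<open>The bracket is \<open>\<Delta>\<close> times the inverse letter; its last
      \<open>x\<close> cancels, leaving \<open>x (flip x)\<close>.\<close>
    also have "\<dots> = inverse Delta *
        (braid_gen x * (braid_gen (flip x) * braid_gen x) * inverse (braid_gen x))"
      unfolding braid_gen_triple by simp
    also have "\<dots> = Delta powi - 1 * pos_braid [x, flip x]"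
      by (simp add: mult.assoc pos_braid_Cons braid3_right_inverse power_int_def)
    finally have "abs_braid3 [l] = Delta powi - 1 * pos_braid [x, flip x]"
      using Pair False by simp
    then show ?thesis by blast
  qed
qed

lemma braid3_eq_Delta_powi_pos_braid: "\<exists>k v. g = Delta powi k * pos_braid v"
proof (induction g rule: braid3.abs_induct)
  fix u
  show "\<exists>k v. abs_braid3 u = Delta powi k * pos_braid v"
  proof (induction u)
    case Nil
    show ?case
      by (intro exI[of _ 0] exI[of _ "[]"]) (simp flip: one_braid3.abs_eq)
  next
    case (Cons l u)
    then obtain k v where "abs_braid3 u = Delta powi k * pos_braid v" by blast
    moreover obtain m x where "abs_braid3 [l] = Delta powi m * pos_braid x"
      using letter_Delta by blast
    moreover have "abs_braid3 (l # u) = abs_braid3 [l] * abs_braid3 u"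
      by (simp add: times_braid3.abs_eq)
    \<comment> \<open>The double twist is the identity; it lets \<open>Delta powi k\<close> move to
      the left past \<open>x\<close>.\<close>
    ultimately have "abs_braid3 (l # u) =
        Delta powi m * (pos_braid (map (twist k) (map (twist k) x)) * Delta powi k) * pos_braid v"
      by (simp add: mult.assoc)
    also have "\<dots> = Delta powi (m + k) * pos_braid (map (twist k) x @ v)"
      by (simp only: Delta_powi_pos_braid[symmetric] braid3_powi_add mult.assoc pos_braid_append)
    finally show ?case by blast
  qed
qed

lemma garside_normal_form:
  obtains k w where "g = Delta powi k * pos_braid w" "Delta_free w"
proof -
  obtain k v where g: "g = Delta powi k * pos_braid v"
    using braid3_eq_Delta_powi_pos_braid by blast
  obtain m w where "pos_braid v = Delta powi m * pos_braid w" "Delta_free w"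
    using pos_braid_decomp by blast
  with g have "g = Delta powi (k + m) * pos_braid w" by (simp add: braid3_powi_add mult.assoc)
  then show thesis using that \<open>Delta_free w\<close> by blast
qed

section \<open>Words for \<open>MB_plus\<close> and uniqueness of the exponent\<close>

lemma pos_braid_in_MB_plus_iff: "pos_braid w \<in> MB_plus \<longleftrightarrow> Delta_free w"
proof
  assume "pos_braid w \<in> MB_plus"
  then have "pos_braid w \<noteq> Delta * pos_braid v" for v by (auto simp: MB_plus_def MB_def)
  then show "Delta_free w" by (metis not_Delta_freeE pos_braid_triple_middle)
next
  assume w: "Delta_free w"
  have "pos_braid w \<noteq> Delta * pos_braid v" for v
  proof
    assume "pos_braid w = Delta * pos_braid v"
    then have "pos_braid ([X1, flip X1, X1] @ v) = pos_braid w"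
      by (simp only: pos_braid_append pos_braid_triple)
    then have "[X1, flip X1, X1] @ v = w" using pos_braid_eq_Delta_free w by blast
    then show False using w by auto
  qed
  then show "pos_braid w \<in> MB_plus" by (auto simp: MB_plus_def MB_def)
qed

lemma MB_plusE:
  assumes "W \<in> MB_plus"
  obtains w where "W = pos_braid w" "Delta_free w"
  using assms pos_braid_in_MB_plus_iff by (auto simp: MB_plus_def MB_def)

lemma word_of_pos_braid: "Delta_free w \<Longrightarrow> word_of (pos_braid w) = w"
  unfolding word_of_def using pos_braid_eq_Delta_free by blast

lemma Delta_powi_pos_braid_in_MB: "Delta ^ n * pos_braid w \<in> MB"
proof (induction n)
  case (Suc n)
  then obtain v where "Delta ^ n * pos_braid w = pos_braid v" by (auto simp: MB_def)
  then have "Delta ^ Suc n * pos_braid w = pos_braid ([X1, flip X1, X1] @ v)"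
    by (simp only: power_Suc mult.assoc pos_braid_append pos_braid_triple)
  then show ?case by (simp add: MB_def)
qed (simp add: MB_def)

lemma garside_exponent_le:
  assumes "Delta powi r * pos_braid w = Delta powi q * V" "V \<in> MB_plus"
  shows "r \<le> q"
proof (rule ccontr)
  assume "\<not> r \<le> q"
  \<comment> \<open>One factor \<open>\<Delta>\<close> of the surplus is kept apart, to exhibit
    \<open>V\<close> as a left multiple of \<open>\<Delta>\<close>.\<close>
  define n where "n = nat (r - q - 1)"
  have "r = q + (1 + int n)" using \<open>\<not> r \<le> q\<close> by (simp add: n_def)
  then have "Delta powi r = Delta powi q * (Delta * Delta ^ n)"
    by (simp only: braid3_powi_add power_int_of_nat power_int_1_right)
  with assms(1) have "V = Delta * (Delta ^ n * pos_braid w)"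
    by (metis braid3_left_cancel mult.assoc)
  with assms(2) Delta_powi_pos_braid_in_MB show False by (auto simp: MB_plus_def)
qed

lemma garside_exponent_unique:
  assumes "Delta powi r * V = Delta powi q * W" "V \<in> MB_plus" "W \<in> MB_plus"
  shows "r = q"
proof -
  obtain v w where "V = pos_braid v" "W = pos_braid w"
    using assms(2,3) by (metis MB_plusE)
  then show ?thesis
    using assms garside_exponent_le[of r v q W] garside_exponent_le[of q w r V] by simp
qed


section \<open>The summit set as an orbit of words\<close>

text \<open>The maximum in \<open>exp_class\<close> is attained: \<open>3 * r + length v\<close> is
  constant on the class, which bounds \<open>r\<close> from above.\<close>

lemma exp_class_greatest:
  assumes "W \<in> MB_plus" "Delta powi q * W \<in> conj_class a"
  shows "q \<le> exp_class (conj_class a)"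
proof -
  define P where "P r \<longleftrightarrow> (\<exists>W\<in>MB_plus. Delta powi r * W \<in> conj_class a)" for r
  have bound: "r \<le> \<bar>expo a\<bar>" if P: "P r" for r
  proof -
    obtain V where V: "V \<in> MB_plus" "Delta powi r * V \<in> conj_class a"
      using P by (auto simp: P_def)
    obtain v where "V = pos_braid v" using MB_plusE[OF V(1)] by metis
    then have "3 * r + int (length v) = expo a" using expo_conj_class[OF V(2)] by simp
    then show ?thesis by simp
  qed
  \<comment> \<open>Cutting off below \<open>q\<close> makes the set finite, and \<open>q\<close>
    keeps it nonempty.\<close>
  define R where "R = {r. P r \<and> q \<le> r}"
  have "R \<subseteq> {q..\<bar>expo a\<bar>}" using bound by (auto simp: R_def)
  then have R: "finite R" by (rule finite_subset) simp
  have q: "q \<in> R" using assms by (auto simp: R_def P_def)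
  have "exp_class (conj_class a) = Max R"
    unfolding exp_class_def P_def[symmetric]
  proof (rule Greatest_equality)
    show "P (Max R)" using Max_in[OF R] q by (auto simp: R_def)
  next
    fix y
    assume "P y"
    show "y \<le> Max R"
    proof (cases "q \<le> y")
      case True
      then show ?thesis using \<open>P y\<close> R by (intro Max_ge) (auto simp: R_def)
    next
      case False
      then show ?thesis using Max_ge[OF R q] by simp
    qed
  qed
  then show ?thesis using Max_ge[OF R q] by simp
qed

lemma summit_word_exp_class:
  assumes "summit_word r W"
  shows "exp_class (conj_class (Delta powi r * W)) = r"
proof -
  obtain q V where "Delta powi r * W = Delta powi q * V" "V \<in> MB_plus" "W \<in> MB_plus"
      "q = exp_class (conj_class (Delta powi r * W))"
    using assms unfolding summit_word_def summit_set_def by blast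
  then show ?thesis using garside_exponent_unique by metis
qed

text \<open>A factor \<open>\<Delta>\<close> in \<open>v\<close> could be extracted and would raise
  the exponent above its maximum.\<close>

lemma summit_exponent_Delta_free:
  assumes "exp_class (conj_class a) = r" "Delta powi r * pos_braid v \<in> conj_class a"
  shows "Delta_free v"
proof (rule ccontr)
  assume v: "\<not> Delta_free v"
  obtain k w where kw: "k \<ge> 0" "\<not> Delta_free v \<longrightarrow> k > 0" "Delta_free w"
      "pos_braid v = Delta powi k * pos_braid w"
    using pos_braid_decomp by blast
  have "Delta powi (r + k) * pos_braid w \<in> conj_class a"
    using assms(2) kw(4) by (simp add: braid3_powi_add mult.assoc)
  then have "r + k \<le> r"
    using exp_class_greatest kw(3) assms(1) pos_braid_in_MB_plus_iff by metis
  then show False using v kw(2) by simp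
qed

text \<open>The moves are conjugations of \<open>\<Delta>\<^sup>r u\<close>: \<open>flip\<close> by
  \<open>\<Delta>\<close>, and \<open>rot\<close> and its inverse \<open>unrot\<close> by the letter
  \<open>twist r x\<close> or its inverse.\<close>

inductive_set orb :: "int \<Rightarrow> gen list \<Rightarrow> gen list set" for r :: int and w :: "gen list" where
  base: "w \<in> orb r w"
| flip: "u \<in> orb r w \<Longrightarrow> map flip u \<in> orb r w"
| rot: "x # u \<in> orb r w \<Longrightarrow> u @ [twist r x] \<in> orb r w"
| unrot: "u @ [twist r x] \<in> orb r w \<Longrightarrow> x # u \<in> orb r w"

lemma length_orb: "v \<in> orb r w \<Longrightarrow> length v = length w"
  by (induction rule: orb.induct) auto

lemma orb_unrot: "u @ [x] \<in> orb r w \<Longrightarrow> twist r x # u \<in> orb r w"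
  using orb.unrot[of u r "twist r x"] by simp

lemma orb_twist: "u \<in> orb r w \<Longrightarrow> map (twist k) u \<in> orb r w"
  by (simp add: map_twist orb.flip)

lemma Delta_powi_gen: "Delta powi r * braid_gen x = braid_gen (twist r x) * Delta powi r"
  using Delta_powi_pos_braid[of r "[x]"] by (simp add: pos_braid_Cons)

lemma orb_conj_class:
  "v \<in> orb r w \<Longrightarrow> Delta powi r * pos_braid v \<in> conj_class (Delta powi r * pos_braid w)"
proof (induction rule: orb.induct)
  case base
  show ?case by (rule conj_class_refl)
next
  case (flip u)
  have "Delta powi r * pos_braid (map flip u) * Delta = Delta powi (r + 1) * pos_braid u"
    by (simp add: mult.assoc braid3_powi_add_one Delta_pos_braid)
  also have "\<dots> = Delta * (Delta powi r * pos_braid u)"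
    using braid3_powi_add[of Delta 1 r] by (simp add: mult.assoc add.commute)
  finally show ?case
    using flip.IH conj_class_trans mem_conj_class_iff by blast
next
  case (rot x u)
  have "Delta powi r * pos_braid (x # u) * braid_gen (twist r x) =
      braid_gen (twist r x) * (Delta powi r * pos_braid (u @ [twist r x]))"
    by (metis Delta_powi_gen mult.assoc pos_braid_Cons pos_braid_append pos_braid_Nil mult_1_right)
  then show ?case
    using rot.IH conj_class_trans mem_conj_class_iff' by blast
next
  case (unrot u x)
  have "Delta powi r * pos_braid (x # u) * braid_gen (twist r x) =
      braid_gen (twist r x) * (Delta powi r * pos_braid (u @ [twist r x]))"
    by (metis Delta_powi_gen mult.assoc pos_braid_Cons pos_braid_append pos_braid_Nil mult_1_right)
  then show ?case
    using unrot.IH conj_class_trans mem_conj_class_iff by blast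
qed

text \<open>
  Conjugation by a \<open>\<Delta>\<close>-free word \<open>g\<close> is performed one simple factor at a time. If \<open>u @ g\<close> has no
  \<open>\<Delta>\<close>, the hypothesis is an equality of words and the first letter of \<open>g\<close> rotates \<open>u\<close>; otherwise a
  \<open>\<Delta>\<close> arises at the junction and a prefix of \<open>g\<close> rotates \<open>u\<close> backwards, up to \<open>flip\<close>.
\<close>
lemma conj_pos_braid_in_orb:
  assumes free: "\<And>v. v \<in> orb r w \<Longrightarrow> Delta_free v"
    and "u \<in> orb r w" "Delta_free g"
    and "pos_braid (u @ g) = pos_braid (map (twist r) g @ v)"
  shows "v \<in> orb r w"
  using assms(2-)
proof (induction "length g" arbitrary: u g rule: less_induct)
  case less
  \<comment> \<open>Peel a prefix \<open>s\<close> off the conjugator: if \<open>s\<close> takes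
    \<open>u\<close> to an orbit word \<open>u'\<close>, then the shorter \<open>g'\<close> takes
    \<open>u'\<close> to \<open>v\<close>.\<close>
  have step: "v \<in> orb r w"
    if g: "g = s @ g'" "s \<noteq> []" and u': "u' \<in> orb r w"
      and eq: "pos_braid (u @ s) = pos_braid (map (twist r) s @ u')" for s g' u'
  proof (rule less.hyps[of g' u'])
    show "length g' < length g" using g by simp
    show "Delta_free g'" using less.prems(2) g Delta_free_appendD by blast
    have "pos_braid (map (twist r) s) * pos_braid (u' @ g') = pos_braid (u @ s) * pos_braid g'"
      unfolding eq by (simp add: pos_braid_append mult.assoc)
    also have "\<dots> = pos_braid (map (twist r) s) * pos_braid (map (twist r) g' @ v)"
      using less.prems(3) by (simp add: g pos_braid_append mult.assoc)
    finally show "pos_braid (u' @ g') = pos_braid (map (twist r) g' @ v)"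
      by (rule braid3_left_cancel)
  qed (use u' in simp)
  have "Delta_free u" using less.prems(1) free by blast
  consider "g = []" | "u = []" | x g' where "g = x # g'" "u \<noteq> []" "Delta_free (u @ g)"
    | "\<not> Delta_free (u @ g)"
    by (cases g) auto
  then show ?case
  proof cases
    case 1
    then have "pos_braid v = pos_braid u" using less.prems(3) by simp
    then show ?thesis using pos_braid_eq_Delta_free \<open>Delta_free u\<close> less.prems(1) by blast
  next
    case 2
    \<comment> \<open>Comparing lengths leaves no letters for \<open>v\<close>.\<close>
    then have "expo (pos_braid g) = expo (pos_braid (map (twist r) g @ v))"
      using less.prems(3) by simp
    then have "v = []" by simp
    then show ?thesis using 2 less.prems(1) by simp
  next
    case (3 x g')
    then have "u @ g = map (twist r) g @ v"
      using pos_braid_eq_Delta_free[OF less.prems(3)[symmetric]] by simp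
    then obtain u' where u: "u = twist r x # u'" using 3 by (cases u) auto
    then have "u' @ [x] \<in> orb r w" using orb.rot[of "twist r x" u' r] less.prems(1) by simp
    then show ?thesis
      using step[of "[x]" g' "u' @ [x]"] 3 u by simp
  next
    case 4
    then show ?thesis
    proof (rule Delta_free_junction[OF \<open>Delta_free u\<close> less.prems(2)])
      fix u0 x g'
      assume u: "u = u0 @ [x, flip x]" and g: "g = x # g'"
      \<comment> \<open>Chosen so that \<open>twist r x # u'\<close> starts with a word for
        \<open>\<Delta>\<close> followed by \<open>map flip u0\<close>. It is also the flip of
        \<open>u\<close> rotated backwards twice.\<close>
      define u' where "u' = map flip (twist r x # twist r (flip x) # u0)"
      have "twist r (flip x) # u0 @ [x] \<in> orb r w"
        using orb_unrot[of "u0 @ [x]" "flip x"] less.prems(1) u by simp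
      then have "twist r x # twist r (flip x) # u0 \<in> orb r w"
        using orb_unrot[of "twist r (flip x) # u0" x] by simp
      then have u': "u' \<in> orb r w" unfolding u'_def by (rule orb.flip)
      have "pos_braid (u @ [x]) = Delta * pos_braid (map flip u0)"
        using pos_braid_triple_middle[of u0 x "[]"] by (simp add: u)
      also have "\<dots> = pos_braid (map (twist r) [x] @ u')"
        using pos_braid_triple_middle[of "[]" "twist r x" "map flip u0"] by (simp add: u'_def)
      finally show ?thesis using step[OF _ _ u', of "[x]" g'] g by simp
    next
      fix u0 x g'
      assume u: "u = u0 @ [flip x]" and g: "g = x # flip x # g'"
      define u' where "u' = map flip (twist r (flip x) # u0)"
      have "twist r (flip x) # u0 \<in> orb r w"
        using orb_unrot[of u0 "flip x"] less.prems(1) u by simp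
      then have u': "u' \<in> orb r w" unfolding u'_def by (rule orb.flip)
      have "pos_braid (u @ [x, flip x]) = Delta * pos_braid (map flip u0)"
        using pos_braid_triple_middle[of u0 "flip x" "[]"] by (simp add: u)
      also have "\<dots> = pos_braid (map (twist r) [x, flip x] @ u')"
        using pos_braid_triple_middle[of "[]" "twist r x" "map flip u0"] by (simp add: u'_def)
      finally show ?thesis using step[OF _ _ u', of "[x, flip x]" g'] g by simp
    qed
  qed
qed

text \<open>In the normal form of the conjugator, the power of \<open>\<Delta>\<close> merely twists
  \<open>w\<close>, which stays in the orbit; the positive part is covered by
  \<open>conj_pos_braid_in_orb\<close>.\<close>

lemma conj_class_in_orb:
  assumes free: "\<And>v. v \<in> orb r w \<Longrightarrow> Delta_free v"
    and "Delta powi r * pos_braid v \<in> conj_class (Delta powi r * pos_braid w)"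
  shows "v \<in> orb r w"
proof -
  obtain h where h: "Delta powi r * pos_braid w * h = h * (Delta powi r * pos_braid v)"
    using assms(2) mem_conj_class_iff' by blast
  obtain k g where g: "h = Delta powi k * pos_braid g" "Delta_free g"
    by (rule garside_normal_form)
  have "pos_braid w * Delta powi k = Delta powi k * pos_braid (map (twist k) w)"
    using Delta_powi_pos_braid[of k "map (twist k) w"] by simp
  then have "Delta powi r * pos_braid w * h =
      Delta powi (r + k) * pos_braid (map (twist k) w @ g)"
    by (simp add: g braid3_powi_add pos_braid_append mult.assoc) (metis mult.assoc)
  moreover have "pos_braid g * Delta powi r = Delta powi r * pos_braid (map (twist r) g)"
    using Delta_powi_pos_braid[of r "map (twist r) g"] by simp
  then have "h * (Delta powi r * pos_braid v) =
      Delta powi (k + r) * pos_braid (map (twist r) g @ v)"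
    by (simp add: g braid3_powi_add pos_braid_append mult.assoc) (metis mult.assoc)
  ultimately have "pos_braid (map (twist k) w @ g) = pos_braid (map (twist r) g @ v)"
    using h braid3_left_cancel by (metis add.commute)
  then show ?thesis
    using conj_pos_braid_in_orb[OF free orb_twist[OF orb.base] g(2)] by blast
qed

abbreviation word_less :: "(gen list \<times> gen list) set" where
  "word_less \<equiv> lenlex {(X1, X2)}"

lemma smallest_summit_word_iff:
  assumes "summit_word r (pos_braid w)"
  shows "smallest_summit_word r (pos_braid w) \<longleftrightarrow>
    (\<forall>v\<in>orb r w. v \<noteq> w \<longrightarrow> (w, v) \<in> word_less)"
proof -
  define C where "C = conj_class (Delta powi r * pos_braid w)"
  have r: "exp_class C = r" using summit_word_exp_class[OF assms] by (simp add: C_def)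
  have free: "Delta_free v" if "Delta powi r * pos_braid v \<in> C" for v
    using summit_exponent_Delta_free r that by (simp add: C_def)
  \<comment> \<open>Orbit words stay in the class, so maximality of \<open>r\<close> makes them free
    of \<open>\<Delta>\<close>, as \<open>conj_class_in_orb\<close> demands.\<close>
  have orb_iff: "Delta powi r * pos_braid v \<in> C \<longleftrightarrow> v \<in> orb r w" for v
    using conj_class_in_orb orb_conj_class free unfolding C_def by blast
  have w: "Delta_free w" using free orb_iff orb.base by blast
  have "base_summit_set C = pos_braid ` orb r w"
  proof (intro equalityI subsetI)
    fix V
    assume "V \<in> base_summit_set C"
    then have V: "V \<in> MB_plus" "Delta powi r * V \<in> C"
      by (auto simp: base_summit_set_def summit_set_def r)
    then show "V \<in> pos_braid ` orb r w" using orb_iff by (auto elim: MB_plusE)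
  next
    fix V
    assume "V \<in> pos_braid ` orb r w"
    then obtain v where v: "V = pos_braid v" "v \<in> orb r w" by blast
    then have "V \<in> MB_plus" "Delta powi r * V \<in> C"
      using orb_iff free pos_braid_in_MB_plus_iff by auto
    then show "V \<in> base_summit_set C"
      using r by (auto simp: base_summit_set_def summit_set_def)
  qed
  moreover have "pos_braid v = pos_braid w \<longleftrightarrow> v = w" for v
    using pos_braid_eq_Delta_free w by blast
  moreover have "word_of (pos_braid v) = v" if "v \<in> orb r w" for v
    using that free orb_iff word_of_pos_braid by blast
  ultimately show ?thesis
    using assms orb.base[of w r] unfolding smallest_summit_word_def less_pos_def C_def[symmetric]
    by auto
qed


section \<open>Alternating words and the max-min condition\<close>

text \<open>With two generators, a syllable form is determined by its first generator and its
  exponents.\<close>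

fun alternating :: "gen \<Rightarrow> nat list \<Rightarrow> gen list" where
  "alternating i [] = []"
| "alternating i (s # t) = replicate s i @ alternating (flip i) t"

lemma length_alternating [simp]: "length (alternating i s) = sum_list s"
  by (induction i s rule: alternating.induct) auto

lemma map_flip_alternating: "map flip (alternating i s) = alternating (flip i) s"
  by (induction i s rule: alternating.induct) auto

lemma drop_alternating:
  "m \<le> a \<Longrightarrow> drop m (alternating i (a # t)) = replicate (a - m) i @ alternating (flip i) t"
  by simp

lemma alternating_snoc:
  "alternating i (s @ [c]) = alternating i s @ replicate c (twist (int (length s)) i)"
  by (induction i s rule: alternating.induct) (auto simp: twist_def)

lemma syllable_prod_alternating:
  assumes "syllable_list ys" "ys \<noteq> []"
  shows "syllable_prod ys = pos_braid (alternating (fst (hd ys)) (map snd ys)) \<and> 0 \<notin> set (map snd ys)"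
  using assms
proof (induction ys)
  case (Cons y ys)
  obtain i s where y: "y = (i, s)" by (cases y)
  have pow: "pos_braid (replicate n i) = braid_gen i ^ n" for n
    by (induction n) (simp_all add: pos_braid_Cons)
  have s: "s \<ge> 1" using Cons.prems(1) by (auto simp: syllable_list_def y)
  show ?case
  proof (cases "ys = []")
    case True
    then show ?thesis using s by (simp add: y syllable_prod_def pow)
  next
    case False
    have alt: "\<forall>j. Suc j < length (y # ys) \<longrightarrow> fst ((y # ys) ! j) \<noteq> fst ((y # ys) ! Suc j)"
      using Cons.prems(1) by (simp add: syllable_list_def)
    have "fst (hd ys) = flip i"
      using spec[OF alt, of 0] False by (simp add: y neq_iff_flip hd_conv_nth)
    moreover have "\<forall>j. Suc j < length ys \<longrightarrow> fst (ys ! j) \<noteq> fst (ys ! Suc j)"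
    proof (intro allI)
      fix j
      show "Suc j < length ys \<longrightarrow> fst (ys ! j) \<noteq> fst (ys ! Suc j)"
        using spec[OF alt, of "Suc j"] by simp
    qed
    then have "syllable_list ys" using Cons.prems(1) by (auto simp: syllable_list_def)
    ultimately show ?thesis
      using Cons.IH False s by (simp add: y syllable_prod_def pos_braid_append pow)
  qed
qed simp

section \<open>The length-lexicographic order on alternating words\<close>

lemma word_less_split: "length u = length v \<Longrightarrow> (p @ X1 # u, p @ X2 # v) \<in> word_less"
  by (auto simp: lenlex_conv lex_conv)

lemma word_less_asym: "(u, v) \<in> word_less \<Longrightarrow> (v, u) \<notin> word_less"
proof -
  have "wf {(X1, X2)}" by (rule wfI_pf) auto
  then have "wf word_less" by (rule wf_lenlex)
  then show "(u, v) \<in> word_less \<Longrightarrow> (v, u) \<notin> word_less" by (rule wf_not_sym)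
qed

lemma word_less_trans: "(u, v) \<in> word_less \<Longrightarrow> (v, w) \<in> word_less \<Longrightarrow> (u, w) \<in> word_less"
proof -
  have "trans {(X1, X2)}" by (auto simp: trans_def)
  then have "trans word_less" by (rule lenlex_transI)
  then show "(u, v) \<in> word_less \<Longrightarrow> (v, w) \<in> word_less \<Longrightarrow> (u, w) \<in> word_less" by (rule transD)
qed

text \<open>At the first differing exponent, \<open>s\<close> continues its syllable while
  \<open>t\<close> already begins the next one. The generator of syllable \<open>j\<close> is
  \<open>twist (int j) i\<close>.\<close>

lemma alternating_split:
  assumes "length s = length t" "sum_list s = sum_list t" "0 \<notin> set t"
    and "j < length s" "s ! j > t ! j" "\<And>l. l < j \<Longrightarrow> s ! l = t ! l"
  shows "\<exists>p u v. alternating i s = p @ twist (int j) i # u \<and>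
    alternating i t = p @ flip (twist (int j) i) # v"
  using assms
proof (induction j arbitrary: i s t)
  case 0
  then obtain a s' b t' where st: "s = a # s'" "t = b # t'"
    by (cases s; cases t) auto
  \<comment> \<open>Equal sums and \<open>a > b\<close> give \<open>t'\<close> a positive sum, so
    \<open>t\<close> does have a next syllable.\<close>
  with 0 obtain c t'' where t': "t' = c # t''" by (cases t') auto
  obtain d where d: "a = b + Suc d" using 0 st less_imp_Suc_add by fastforce
  obtain e where e: "c = Suc e" using 0 st t' by (cases c) auto
  have "alternating i s = replicate b i @ i # (replicate d i @ alternating (flip i) s')"
    by (simp add: st d replicate_add replicate_append_same)
  moreover have "alternating i t = replicate b i @ flip i # (replicate e (flip i) @ alternating i t'')"
    by (simp add: st t' e)
  ultimately show ?case by (auto simp: twist_def)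
next
  case (Suc j)
  then obtain a s' b t' where st: "s = a # s'" "t = b # t'"
    by (cases s; cases t) auto
  have ab: "a = b" using Suc.prems(6)[of 0] st by simp
  have "s' ! l = t' ! l" if "l < j" for l using Suc.prems(6)[of "Suc l"] st that by simp
  then obtain p u v where "alternating (flip i) s' = p @ twist (int j) (flip i) # u"
      "alternating (flip i) t' = p @ flip (twist (int j) (flip i)) # v"
    using Suc.IH[of s' t' "flip i"] Suc.prems st ab by auto
  then have "alternating i s = (replicate a i @ p) @ twist (int (Suc j)) i # u"
      "alternating i t = (replicate a i @ p) @ flip (twist (int (Suc j)) i) # v"
    by (auto simp: st ab twist_def)
  then show ?case by blast
qed

text \<open>Even indices carry \<open>X1\<close>, where the longer syllable delays
  \<open>X2\<close>; odd indices carry \<open>X2\<close>, where the shorter one returns to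
  \<open>X1\<close> sooner.\<close>

lemma alternating_less:
  assumes "length s = length t" "sum_list s = sum_list t" "0 \<notin> set s" "0 \<notin> set t"
    and "j < length s" "if even j then s ! j > t ! j else s ! j < t ! j"
    and "\<And>l. l < j \<Longrightarrow> s ! l = t ! l"
  shows "(alternating X1 s, alternating X1 t) \<in> word_less"
proof -
  have "\<exists>p u v. alternating X1 s = p @ X1 # u \<and> alternating X1 t = p @ X2 # v"
  proof (cases "even j")
    case True
    then show ?thesis using alternating_split[of s t j X1] assms by (simp add: twist_def)
  next
    case False
    then show ?thesis using alternating_split[of t s j X1] assms by (force simp: twist_def)
  qed
  then obtain p u v where *: "alternating X1 s = p @ X1 # u" "alternating X1 t = p @ X2 # v" by blast
  have "length (alternating X1 s) = length (alternating X1 t)" using assms by simp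
  then show ?thesis unfolding * by (intro word_less_split) simp
qed

lemma first_difference:
  assumes "length s = length t" "s \<noteq> t"
  obtains j where "j < length s" "s ! j \<noteq> t ! j" "\<And>l. l < j \<Longrightarrow> s ! l = t ! l"
proof -
  have "\<exists>j. j < length s \<and> s ! j \<noteq> t ! j" using assms nth_equalityI by blast
  then obtain j where "j < length s \<and> s ! j \<noteq> t ! j" "\<And>l. l < j \<Longrightarrow> \<not> (l < length s \<and> s ! l \<noteq> t ! l)"
    by (auto simp: exists_least_iff[of "\<lambda>j. j < length s \<and> s ! j \<noteq> t ! j"])
  then show thesis by (intro that[of j]) auto
qed

lemma alternating_less_linear:
  assumes "length s = length t" "sum_list s = sum_list t" "0 \<notin> set s" "0 \<notin> set t" "s \<noteq> t"
  shows "(alternating X1 s, alternating X1 t) \<in> word_less \<or>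
    (alternating X1 t, alternating X1 s) \<in> word_less"
proof -
  obtain j where j: "j < length s" "s ! j \<noteq> t ! j" "\<And>l. l < j \<Longrightarrow> s ! l = t ! l"
    using first_difference[OF assms(1,5)] by blast
  show ?thesis
  proof (cases "if even j then s ! j > t ! j else s ! j < t ! j")
    case True
    then show ?thesis using alternating_less[of s t j] j assms by blast
  next
    case False
    then have "if even j then t ! j > s ! j else t ! j < s ! j"
      using j(2) by (auto split: if_splits)
    then show ?thesis using alternating_less[of t s j] j assms by simp
  qed
qed

lemma sum_list_rotate [simp]: "sum_list (rotate k s) = sum_list s" for s :: "nat list"
  by (metis add.commute append_take_drop_id rotate_drop_take sum_list_append)

text \<open>All rotations are read from \<open>X1\<close>, even for odd \<open>k\<close>; in the
  orbit, \<open>flip\<close> makes up for this.\<close>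

lemma max_min_iff:
  assumes "0 \<notin> set s"
  shows "max_min s \<longleftrightarrow>
    (\<forall>k. rotate k s = s \<or> (alternating X1 s, alternating X1 (rotate k s)) \<in> word_less)"
proof (intro iffI allI)
  fix k
  assume mm: "max_min s"
  define t where "t = rotate (k mod length s) s"
  have t: "rotate k s = t" by (simp add: t_def rotate_conv_mod[of k])
  show "rotate k s = s \<or> (alternating X1 s, alternating X1 (rotate k s)) \<in> word_less"
  proof (subst disj_imp, rule impI)
    assume "rotate k s \<noteq> s"
    then obtain j where j: "j < length s" "s ! j \<noteq> t ! j" "\<And>l. l < j \<Longrightarrow> s ! l = t ! l"
      using first_difference[of s t] t by (metis length_rotate)
    then have "k mod length s < length s" by (intro mod_less_divisor) linarith
    then have "if even j then s ! j > t ! j else s ! j < t ! j"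
      using mm j unfolding max_min_def t_def Let_def by blast
    then show "(alternating X1 s, alternating X1 (rotate k s)) \<in> word_less"
      unfolding t using j assms by (intro alternating_less) (auto simp: t_def)
  qed
next
  assume less: "\<forall>k. rotate k s = s \<or> (alternating X1 s, alternating X1 (rotate k s)) \<in> word_less"
  show "max_min s"
    unfolding max_min_def Let_def
  proof (intro allI impI, rule ccontr)
    fix k j
    assume "k < length s" and j: "j < length s"
      and diff: "s ! j \<noteq> rotate k s ! j \<and> (\<forall>l<j. s ! l = rotate k s ! l)"
      and "\<not> (if even j then rotate k s ! j < s ! j else s ! j < rotate k s ! j)"
    then have "if even j then rotate k s ! j > s ! j else rotate k s ! j < s ! j"
      by (auto split: if_splits)
    then have "(alternating X1 (rotate k s), alternating X1 s) \<in> word_less"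
      using j diff assms by (intro alternating_less) auto
    moreover have "rotate k s \<noteq> s" using diff by auto
    ultimately show False using less word_less_asym by blast
  qed
qed

text \<open>
  When the number of syllables has the parity of \<open>r\<close>, the ends of the word do not merge under
  twisted rotation, so the orbit consists of rotations that cut the first syllable after \<open>m\<close> letters.
\<close>
lemma orb_alternating:
  assumes "v \<in> orb r (alternating i0 s)" "s \<noteq> []" "0 \<notin> set s" "even (int (length s) + r)"
  shows "\<exists>i k m. m < hd (rotate k s) \<and>
    v = drop m (alternating i (rotate k s)) @ replicate m (twist r i)"
  using assms(1)
proof (induction rule: orb.induct)
  case base
  have "0 < hd (rotate 0 s)" using assms(2,3) by (cases s) auto
  then show ?case by (intro exI[of _ i0] exI[of _ 0]) simp
next
  case (flip u)
  then obtain i k m where "m < hd (rotate k s)"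
      "u = drop m (alternating i (rotate k s)) @ replicate m (twist r i)" by blast
  then show ?case
    by (intro exI[of _ "flip i"] exI[of _ k] exI[of _ m])
      (simp add: map_flip_alternating flip: drop_map)
next
  case (rot x u)
  then obtain i k m where m: "m < hd (rotate k s)"
      and u: "x # u = drop m (alternating i (rotate k s)) @ replicate m (twist r i)" by blast
  obtain a t' where t: "rotate k s = a # t'" using assms(2) by (cases "rotate k s") auto
  obtain d where d: "a = m + Suc d" using m t less_imp_Suc_add by fastforce
  have xu: "x = i" "u = replicate d i @ alternating (flip i) t' @ replicate m (twist r i)"
    using u[unfolded t] by (subst (asm) drop_alternating; simp add: d)+
  show ?case
  proof (cases d)
    case 0
    have "length s = Suc (length t')" using t by (metis length_rotate length_Cons)
    \<comment> \<open>The whole first syllable has now moved. By the parity hypothesis it arrives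
      with the generator that continues the alternation.\<close>
    then have "twist (int (length t')) (flip i) = twist r i"
      using assms(4) by (auto simp: twist_def)
    then have "u @ [twist r x] = alternating (flip i) (t' @ [a])"
      by (simp add: xu 0 d alternating_snoc replicate_append_same)
    moreover have "t' @ [a] = rotate (Suc k) s" by (simp add: t)
    moreover have "0 < hd (rotate (Suc k) s)"
      using assms(2,3) by (metis hd_in_set set_rotate rotate_is_Nil_conv gr0I)
    ultimately show ?thesis by (intro exI[of _ "flip i"] exI[of _ "Suc k"] exI[of _ 0]) simp
  next
    case (Suc e)
    have "u @ [twist r x] = drop (Suc m) (alternating i (rotate k s)) @ replicate (Suc m) (twist r i)"
      unfolding t by (subst drop_alternating) (simp_all add: xu d Suc replicate_append_same)
    then show ?thesis using t d Suc
      by (intro exI[of _ i] exI[of _ k] exI[of _ "Suc m"]) simp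
  qed
next
  case (unrot u x)
  then obtain i k m where m: "m < hd (rotate k s)"
      and u: "u @ [twist r x] = drop m (alternating i (rotate k s)) @ replicate m (twist r i)" by blast
  show ?case
  proof (cases m)
    case 0
    \<comment> \<open>With no letter to take back, the step enters the preceding rotation of
      \<open>s\<close>: one letter of its first syllable \<open>c\<close> is in front, the other
      \<open>e\<close> are still at the end.\<close>
    obtain t' c where t: "rotate k s = t' @ [c]" using assms(2)
      by (metis rotate_is_Nil_conv rev_exhaust)
    have "c \<in> set s" using t by (metis in_set_conv_decomp set_rotate)
    then obtain e where e: "c = Suc e" using assms(3) by (metis not0_implies_Suc)
    have "length s = Suc (length t')" using t by (metis length_rotate length_append_singleton)
    then have tw: "twist (int (length t')) i = twist r (flip i)"
      using assms(4) by (auto simp: twist_def)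
    have "u @ [twist r x] = (alternating i t' @ replicate e (twist r (flip i))) @ [twist r (flip i)]"
      using u by (simp only: 0 t alternating_snoc tw e)
        (simp add: replicate_append_same)
    then have xu: "twist r x = twist r (flip i)" "u = alternating i t' @ replicate e (twist r (flip i))"
      by (simp_all only: append1_eq_conv)
    then have "x = flip i" by (metis twist_twist)
    then have "x # u = drop e (alternating (flip i) (c # t')) @ replicate e (twist r (flip i))"
      by (subst drop_alternating) (simp_all add: xu e)
    \<comment> \<open>Rotating by \<open>length s - 1\<close> further is rotating back by
      one.\<close>
    moreover have "rotate (length t' + k) s = c # t'"
      using t by (simp add: rotate_append flip: rotate_rotate)
    moreover have "e < hd (c # t')" using e by simp
    ultimately show ?thesis by metis
  next
    case (Suc m')
    obtain a t' where t: "rotate k s = a # t'" using assms(2) by (cases "rotate k s") auto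
    obtain d where d: "a = m + Suc d" using m t less_imp_Suc_add by fastforce
    have "u @ [twist r x] =
        (drop m (alternating i (rotate k s)) @ replicate m' (twist r i)) @ [twist r i]"
      using u by (simp add: Suc replicate_append_same)
    then have "twist r x = twist r i"
      and xu: "u = drop m (alternating i (rotate k s)) @ replicate m' (twist r i)"
      by (simp_all only: append1_eq_conv)
    then have "x = i" by (metis twist_twist)
    then have "x # u = drop m' (alternating i (rotate k s)) @ replicate m' (twist r i)"
      using drop_alternating[of m a i t'] drop_alternating[of m' a i t']
      unfolding t xu by (simp add: d Suc del: alternating.simps)
    then show ?thesis using m Suc by (intro exI[of _ i] exI[of _ k] exI[of _ m']) simp
  qed
qed

text \<open>Orbit words that start with \<open>X2\<close> are larger at once. Among those that start
  with \<open>X1\<close>, a cut first syllable reaches \<open>X2\<close> earlier than the uncut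
  rotation, and uncut rotations are handled by \<open>max_min_iff\<close>.\<close>

lemma max_min_imp_least:
  assumes "max_min s" "s \<noteq> []" "0 \<notin> set s" "even (int (length s) + r)"
    and "v \<in> orb r (alternating X1 s)" "v \<noteq> alternating X1 s"
  shows "(alternating X1 s, v) \<in> word_less"
proof -
  obtain i k m where m: "m < hd (rotate k s)"
      and v: "v = drop m (alternating i (rotate k s)) @ replicate m (twist r i)"
    using orb_alternating[OF assms(5,2,3,4)] by blast
  have len: "length v = sum_list s" using length_orb[OF assms(5)] by simp
  obtain a t where t: "rotate k s = a # t" using assms(2) by (cases "rotate k s") auto
  obtain d where d: "a = m + Suc d" using m t less_imp_Suc_add by fastforce
  have v': "v = replicate (Suc d) i @ alternating (flip i) t @ replicate m (twist r i)"
    unfolding v t by (subst drop_alternating) (simp_all add: d)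
  have least: "alternating X1 s = alternating X1 (rotate k s) \<or>
      (alternating X1 s, alternating X1 (rotate k s)) \<in> word_less"
    using assms(1,3) max_min_iff by metis
  show ?thesis
  proof (cases i)
    case X2
    obtain z where z: "alternating X1 s = X1 # z"
      using assms(2,3) by (cases s; cases "hd s") auto
    then have "length z = length (replicate d X2 @ alternating X1 t @ replicate m (twist r X2))"
      using len length_alternating[of X1 s] by (simp add: v' X2)
    from word_less_split[OF this, of "[]"] show ?thesis by (simp add: z v' X2)
  next
    case X1
    show ?thesis
    proof (cases m)
      case 0
      then show ?thesis using least assms(6) by (auto simp: v X1)
    next
      case (Suc n)
      \<comment> \<open>The letter after the shortened syllable is \<open>X2\<close>. With a single
        syllable \<open>r\<close> is odd, so the moved letters themselves have become
        \<open>X2\<close>.\<close>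
      have "\<exists>z. alternating X2 t @ replicate m (twist r X1) = X2 # z"
      proof (cases t)
        case Nil
        then have "length s = 1" using t by (metis length_rotate length_Cons list.size(3) One_nat_def)
        then have "twist r X1 = X2" using assms(4) by (simp add: twist_def)
        then show ?thesis by (simp add: Nil Suc)
      next
        case (Cons b t')
        then have "b \<in> set s" using t by (metis list.set_intros set_rotate)
        then obtain e where "b = Suc e" using assms(3) by (metis not0_implies_Suc)
        then show ?thesis by (simp add: Cons)
      qed
      then obtain z where z: "alternating X2 t @ replicate m (twist r X1) = X2 # z" by blast
      have rk: "alternating X1 (rotate k s) =
          replicate (Suc d) X1 @ X1 # (replicate n X1 @ alternating X2 t)"
        by (simp add: t d Suc replicate_add replicate_append_same)
          (metis append_Cons replicate_Suc replicate_add add.commute append_assoc)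
      have vz: "v = replicate (Suc d) X1 @ X2 # z" using z by (simp add: v' X1)
      have "length (alternating X1 (rotate k s)) = length v"
        by (simp only: length_alternating len sum_list_rotate)
      then have "(alternating X1 (rotate k s), v) \<in> word_less"
        unfolding rk vz by (intro word_less_split) simp
      then show ?thesis using least word_less_trans by metis
    qed
  qed
qed

lemma orb_rotate_syllable:
  "replicate c x @ u \<in> orb r w \<Longrightarrow> u @ replicate c (twist r x) \<in> orb r w"
proof (induction c arbitrary: u)
  case (Suc c)
  then have "replicate c x @ (u @ [twist r x]) \<in> orb r w"
    using orb.rot[of x "replicate c x @ u" r] by simp
  from Suc.IH[OF this] show ?case by simp
qed simp

text \<open>By parity, a first syllable that is moved to the end continues the alternation;
  \<open>flip\<close> then restores the starting generator.\<close>

lemma alternating_rotate_in_orb: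
  assumes "even (int (length s) + r)"
  shows "alternating i (rotate k s) \<in> orb r (alternating i s)"
proof (induction k)
  case (Suc k)
  show ?case
  proof (cases "rotate k s")
    case (Cons a t)
    have len: "length s = Suc (length t)" using Cons by (metis length_rotate length_Cons)
    then have "twist (int (length t)) i = flip (twist r i)"
      using assms by (auto simp: twist_def len)
    then have "alternating i (rotate (Suc k) s) = map flip (alternating (flip i) t @ replicate a (twist r i))"
      by (simp add: Cons alternating_snoc map_flip_alternating)
    then show ?thesis
      using Suc orb_rotate_syllable orb.flip by (simp only: Cons alternating.simps)
  next
    case Nil
    then show ?thesis using Suc by simp
  qed
qed (simp add: orb.base)

text \<open>Leastness forces the start \<open>X1\<close>, by comparison with the flipped word. With
  the right parity only rotations remain to be compared; with the wrong one the two ends merge, and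
  several syllables then admit a smaller word.\<close>

lemma alternating_least_iff:
  assumes "s \<noteq> []" "0 \<notin> set s"
  shows "(\<forall>v\<in>orb r (alternating i s). v \<noteq> alternating i s \<longrightarrow>
      (alternating i s, v) \<in> word_less) \<longleftrightarrow>
    (even r \<and> (\<exists>n. alternating i s = replicate n X1)) \<or>
    (i = X1 \<and> even (int (length s) + r) \<and> max_min s)"
    (is "?least \<longleftrightarrow> ?const \<or> ?cond")
proof (intro iffI)
  assume ?least
  then have least: "(v, alternating i s) \<notin> word_less" if "v \<in> orb r (alternating i s)" for v
    using that word_less_asym[of v "alternating i s"] word_less_asym[of "alternating i s" v] by metis
  obtain a t where s: "s = Suc a # t" using assms by (cases s; cases "hd s") auto
  have i: "i = X1"
  proof (rule ccontr)
    assume "i \<noteq> X1"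
    then have "i = X2" by (cases i) auto
    then have w: "alternating i s = [] @ X2 # replicate a X2 @ alternating X1 t"
      and f: "map flip (alternating i s) = [] @ X1 # replicate a X1 @ alternating X2 t"
      by (simp_all add: s map_flip_alternating)
    have "(map flip (alternating i s), alternating i s) \<in> word_less"
      unfolding f unfolding w by (rule word_less_split) (simp add: length_alternating)
    then show False using least orb.flip[OF orb.base] by blast
  qed
  show "?const \<or> ?cond"
  proof (cases "even (int (length s) + r)")
    case True
    have "rotate k s = s \<or> (alternating X1 s, alternating X1 (rotate k s)) \<in> word_less" for k
      using alternating_less_linear[of s "rotate k s"] least[of "alternating X1 (rotate k s)"]
        alternating_rotate_in_orb[OF True] i assms(2)
      by (cases "rotate k s = s") auto
    then show ?thesis using max_min_iff[OF assms(2)] i True by blast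
  next
    case False
    show ?thesis
    proof (cases t)
      case Nil
      \<comment> \<open>A single syllable of the wrong parity means that \<open>r\<close> is even,
        which is the constant case.\<close>
      then show ?thesis using False by (simp add: s i) (metis replicate_Suc)
    next
      case (Cons b t')
      obtain c where c: "b = Suc c" using assms by (cases b) (auto simp: s Cons)
      obtain s' e where s': "s = s' @ [e]" using assms(1) by (metis rev_exhaust)
      obtain f where e: "e = Suc f" using assms(2) by (cases e) (auto simp: s')
      have tw: "twist (int (length s')) X1 = twist r X1"
        using False by (auto simp: s' twist_def)
      have w: "alternating i s = replicate (Suc a) X1 @ X2 # replicate c X2 @ alternating X1 t'"
        by (simp add: s i Cons c)
      define u where "u = alternating X1 s' @ replicate f (twist r X1)"
      have w': "alternating i s = u @ [twist r X1]"
        by (simp add: s' i e alternating_snoc tw u_def replicate_append_same)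
      \<comment> \<open>Undoing a rotation brings the last letter to the front as \<open>X1\<close>,
        which lengthens the first syllable by one.\<close>
      then have "X1 # u \<in> orb r (alternating i s)"
        by (metis orb.unrot orb.base)
      moreover have "u = replicate (Suc a) X1 @ butlast (X2 # replicate c X2 @ alternating X1 t')"
        using w w' by (metis butlast_append butlast_snoc list.distinct(1))
      then have u: "X1 # u = replicate (Suc a) X1 @ X1 # butlast (X2 # replicate c X2 @ alternating X1 t')"
        by (metis append_Cons replicate_Suc replicate_app_Cons_same)
      have "(X1 # u, alternating i s) \<in> word_less"
        unfolding u unfolding w
        by (rule word_less_split) (simp only: length_butlast length_Cons diff_Suc_1)
      ultimately show ?thesis using least by blast
    qed
  qed
next
  assume "?const \<or> ?cond"
  then show ?least
  proof
    assume ?cond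
    then show ?least using max_min_imp_least assms by blast
  next
    assume ?const
    then obtain n where r: "even r" and n: "alternating i s = replicate n X1" by blast
    have "n \<noteq> 0"
      using n assms by (cases n; cases s; cases "hd s") auto
    then obtain m where m: "n = Suc m" by (metis not0_implies_Suc)
    \<comment> \<open>For even \<open>r\<close>, rotations fix a constant word, so the only possible
      competitor is the power of \<open>X2\<close>.\<close>
    have "\<exists>j. v = replicate n j" if "v \<in> orb r (replicate n X1)" for v
      using that
    proof induction
      case (rot x u)
      then obtain j where j: "x # u = replicate n j" by blast
      then have "x = j" "u = replicate m j" by (simp_all add: m)
      then have "u @ [twist r x] = replicate n j"
        using r by (simp add: m twist_def replicate_append_same)
      then show ?case by blast
    next
      case (unrot u x)
      then obtain j where "u @ [x] = replicate n j" using r by (auto simp: twist_def)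
      then have "u @ [x] = replicate m j @ [j]" by (simp add: m replicate_append_same)
      then have "x # u = replicate n j" by (simp add: m)
      then show ?case by blast
    qed auto
    moreover have "(replicate n X1, replicate n X2) \<in> word_less"
      using word_less_split[of "replicate m X1" "replicate m X2" "[]"] by (simp add: m)
    ultimately show ?least unfolding n by (metis gen.exhaust)
  qed
qed

theorem theorem4:
  fixes r :: int and W :: braid3 and ys :: "(gen \<times> nat) list"
  assumes "syllable_list ys" and "W = syllable_prod ys"
    and "summit_word r W"
  shows "smallest_summit_word r W \<longleftrightarrow>
    ((odd r \<and> W = 1) \<or> (even r \<and> (\<exists>s::nat. W = braid_gen X1 ^ s))) \<or>
    (ys \<noteq> [] \<and> fst (hd ys) = X1 \<and>
     [int (length ys) = r] (mod 2) \<and>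
     max_min (map snd ys))"
proof (cases "ys = []")
  case True
  then have W: "W = 1" using assms(2) by (simp add: syllable_prod_def)
  \<comment> \<open>The empty word is alone in its orbit, and condition (0) covers it for both
    parities of \<open>r\<close>.\<close>
  have "v = []" if "v \<in> orb r []" for v
    using length_orb[OF that] by simp
  then have "smallest_summit_word r W"
    using smallest_summit_word_iff[of r "[]"] assms(3) W by auto
  moreover have "W = braid_gen X1 ^ 0" by (simp add: W)
  ultimately show ?thesis using W by blast
next
  case False
  define i s where "i = fst (hd ys)" and "s = map snd ys"
  have W: "W = pos_braid (alternating i s)" and s: "s \<noteq> []" "0 \<notin> set s"
    using syllable_prod_alternating[OF assms(1) False] False assms(2) by (auto simp: i_def s_def)
  have "Delta_free (alternating i s)"
    using assms(3) pos_braid_in_MB_plus_iff W by (auto simp: summit_word_def)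
  then have eq_W: "W = pos_braid v \<longleftrightarrow> alternating i s = v" for v
    using pos_braid_eq_Delta_free W by metis
  have pow: "braid_gen X1 ^ n = pos_braid (replicate n X1)" for n
    by (induction n) (simp_all add: pos_braid_Cons)
  have "alternating i s \<noteq> []" using s by (cases s; cases "hd s") auto
  \<comment> \<open>This rules out the alternative of (0) with odd \<open>r\<close>.\<close>
  then have "W \<noteq> 1" using eq_W[of "[]"] by simp
  moreover have "[int (length ys) = r] (mod 2) \<longleftrightarrow> even (int (length s) + r)"
    by (simp add: s_def cong_iff_dvd_diff)
  moreover have "W = braid_gen X1 ^ n \<longleftrightarrow> alternating i s = replicate n X1" for n
    unfolding pow by (rule eq_W)
  ultimately show ?thesis
    using smallest_summit_word_iff[of r "alternating i s"] alternating_least_iff[OF s] assms(3) False W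
    unfolding i_def[symmetric] s_def[symmetric] by auto
qed

end
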